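(* Let $(X,\mathcal{B})$ be a primitive uniform space, and let $F\colon X\to 2^{X}$ be a mapping such that, for every $x\in X$, the set $c_{\mathcal{B}}(F(x))$ is a singleton and $c_{\mathcal{B}}(F(x))\subset F(x)$. Let $f=c_{\mathcal{B}}\circ F\colon X\to X$, i.e. $f(z)$ is the unique element of $c_{\mathcal{B}}(F(z))$ for each $z\in X$. Assume that $f$ is nonexpansive, and that for some $\emptyset\neq Y\subset X$ we have $f(Y)\subset Y$ (e.g. this holds if $F(Y)\subset Y$) and $x\in c_{\mathcal{B}}(f_{\mid Y})$. Then $f(x)\in c_{\mathcal{B}}(f_{\mid Y})$, and $x$ is a fixed point of $F$ (i.e. $x\in F(x)$) provided that $c_{\mathcal{B}}(f_{\mid Y})$ is a singleton.
   Context: A primitive uniform space is a pair $(X,\mathcal{B})$, where $X$ is a nonempty set and $\mathcal{B}$ is a family of subsets of $X\times X$ such that $X\times X\in\mathcal{B}$ (no other condition is imposed on $\mathcal{B}$). For $B\in\mathcal{B}$, $x\in X$ and $A\subset X$ write $B(x)=\{y\in X:(x,y)\in B\}$ and $B(A)=\bigcup_{a\in A}B(a)$. A (multivalued) mapping $F\colon Y\to 2^{Y}$ assigns to each $y\in Y$ a nonempty subset $F(y)\subset Y$ (likewise for $F\colon X\to 2^{X}$); $F(A)=\bigcup_{a\in A}F(a)$ and $F^{n}(Y)$ denotes the $n$-th iterated image of $Y$ under $F$, $n\in\mathbb{N}$. A single-valued mapping $f$ is identified with $y\mapsto\{f(y)\}$. A mapping $G\colon X\to 2^{X}$ is nonexpansive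 if $G(B(x))\subset B(G(x))$ for all $x\in X$ and $B\in\mathcal{B}$; thus a single-valued $f\colon X\to X$ is nonexpansive if $f(B(x))\subset B(f(x))$ for all $x\in X$, $B\in\mathcal{B}$. Centre of a set: for a nonempty $A\subset X$, a point $x\in X$ is a central point for $A$ if $$\bigcap\{B\in\mathcal{B}: A\subset B(z)\text{ for some } z\in X\}=\bigcap\{B\in\mathcal{B}: A\subset B(x)\};$$ the centre $c_{\mathcal{B}}(A)$ is the set of all central points for $A$. Centre of a mapping: let $\emptyset\neq Y\subset X$ and let $G\colon Y\to 2^{Y}$ be a mapping. A point $x\in X$ is a central point for $G$ if $$\bigcap\{B\in\mathcal{B}: G^{n}(Y)\subset B(z)\text{ for some } n\in\mathbb{N}\text{ and some } z\in X\}=\bigcap\{B\in\mathcal{B}: G^{n}(Y)\subset B(x)\text{ for some } n\in\mathbb{N}\}.$$ The centre $c_{\mathcal{B}}(G)$ of $G$ is the set of all central points for $G$. Here $f_{\mid Y}$ is the restriction of $f$ to $Y$, regarded as a mapping of $Y$ into $Y$. *)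

theory Defs
  imports Main "HOL-Library.FuncSet"
begin

definition primitive_uniform_space :: "'a set \<Rightarrow> 'a rel set \<Rightarrow> bool" where
  "primitive_uniform_space X \<B> \<longleftrightarrow> X \<noteq> {} \<and> \<B> \<subseteq> Pow (X \<times> X) \<and> X \<times> X \<in> \<B>"

text \<open>For an entourage \<open>B\<close>, the sets \<open>B(x)\<close> and \<open>B(A)\<close> are the relational images
  \<open>B `` {x}\<close> and \<open>B `` A\<close>. A multivalued mapping \<open>G : Y \<rightarrow> 2\<^sup>Y\<close> is a function into sets,
  of which only the values on \<open>Y\<close> are relevant.\<close>

definition multimap_on :: "'a set \<Rightarrow> ('a \<Rightarrow> 'a set) \<Rightarrow> bool" where
  "multimap_on Y G \<longleftrightarrow> (\<forall>y\<in>Y. G y \<noteq> {} \<and> G y \<subseteq> Y)"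

definition mimage :: "('a \<Rightarrow> 'a set) \<Rightarrow> 'a set \<Rightarrow> 'a set" where
  "mimage G A = (\<Union>a\<in>A. G a)"

definition as_multimap :: "('a \<Rightarrow> 'a) \<Rightarrow> 'a \<Rightarrow> 'a set" where
  "as_multimap f = (\<lambda>y. {f y})"

definition nonexpansive :: "'a set \<Rightarrow> 'a rel set \<Rightarrow> ('a \<Rightarrow> 'a set) \<Rightarrow> bool" where
  "nonexpansive X \<B> G \<longleftrightarrow> (\<forall>x\<in>X. \<forall>B\<in>\<B>. mimage G (B `` {x}) \<subseteq> B `` G x)"

definition set_centre :: "'a set \<Rightarrow> 'a rel set \<Rightarrow> 'a set \<Rightarrow> 'a set" where
  "set_centre X \<B> A =
     {x \<in> X. \<Inter>{B \<in> \<B>. \<exists>z\<in>X. A \<subseteq> B `` {z}} = \<Inter>{B \<in> \<B>. A \<subseteq> B `` {x}}}"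

text \<open>For \<open>G : Y \<rightarrow> 2\<^sup>Y\<close> the iterated images of \<open>Y\<close> decrease, so it makes no difference below
  whether \<open>n\<close> starts from 0 or from 1.\<close>

definition map_centre :: "'a set \<Rightarrow> 'a rel set \<Rightarrow> 'a set \<Rightarrow> ('a \<Rightarrow> 'a set) \<Rightarrow> 'a set" where
  "map_centre X \<B> Y G =
     {x \<in> X. \<Inter>{B \<in> \<B>. \<exists>n. \<exists>z\<in>X. (mimage G ^^ n) Y \<subseteq> B `` {z}} =
             \<Inter>{B \<in> \<B>. \<exists>n. (mimage G ^^ n) Y \<subseteq> B `` {x}}}"

end

theory Submission
  imports Defs
begin

text \<open>
  The family of entourages \<open>B\<close> for which some iterated image of \<open>Y\<close> lies in \<open>B(x)\<close> can only
  grow when \<open>x\<close> is replaced by \<open>f(x)\<close>: if \<open>f\<^sup>n(Y) \<subseteq> B(x)\<close>, then applying \<open>f\<close> once more and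
  using nonexpansiveness gives \<open>f\<^sup>n\<^sup>+\<^sup>1(Y) \<subseteq> f(B(x)) \<subseteq> B(f(x))\<close>. The intersection of this
  family therefore shrinks on passing from \<open>x\<close> to \<open>f(x)\<close>. Centrality of \<open>x\<close> says that its
  intersection is already the smallest possible one, the intersection over all candidate
  points \<open>z\<close>, and so the same holds for \<open>f(x)\<close>: the centre of \<open>f\<close> on \<open>Y\<close> is invariant under
  \<open>f\<close> (lemma \<open>map_centre_invariant\<close>).

  If the centre is a singleton, invariance forces \<open>f(x) = x\<close>. As \<open>f\<close> is a selection of \<open>F\<close>,
  this gives \<open>x \<in> F(x)\<close>.
\<close>

lemma mimage_as_multimap [simp]: "mimage (as_multimap g) A = g ` A"
  by (auto simp: mimage_def as_multimap_def)

lemma nonexpansive_as_multimapD: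
  assumes "nonexpansive X \<B> (as_multimap f)" and "x \<in> X" and "B \<in> \<B>"
  shows "f ` (B `` {x}) \<subseteq> B `` {f x}"
proof -
  have "mimage (as_multimap f) (B `` {x}) \<subseteq> B `` as_multimap f x"
    using assms unfolding nonexpansive_def by blast
  then show ?thesis
    by (simp only: mimage_as_multimap) (simp add: as_multimap_def)
qed

text \<open>The iterates never leave \<open>Y\<close>, and there the restriction agrees with \<open>f\<close>.\<close>

lemma mimage_restrict_Suc:
  assumes "f ` Y \<subseteq> Y"
  shows "(mimage (as_multimap (restrict f Y)) ^^ Suc n) Y =
    f ` (mimage (as_multimap (restrict f Y)) ^^ n) Y"
proof -
  have "(mimage (as_multimap (restrict f Y)) ^^ n) Y \<subseteq> Y"
    using assms by (induction n) auto
  then show ?thesis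
    by (auto simp: image_iff subset_iff)
qed

text \<open>The base point moves from \<open>x\<close> to \<open>f x\<close> at the cost of one more iterate, which the
  definition of the centre allows, as it asks only for some iterate.\<close>

lemma map_centre_invariant:
  assumes nonexp: "nonexpansive X \<B> (as_multimap f)"
    and fY: "f ` Y \<subseteq> Y"
    and x: "x \<in> map_centre X \<B> Y (as_multimap (restrict f Y))"
    and fx: "f x \<in> X"
  shows "f x \<in> map_centre X \<B> Y (as_multimap (restrict f Y))"
proof -
  define I where "I n = (mimage (as_multimap (restrict f Y)) ^^ n) Y" for n
  define N where "N z = {B \<in> \<B>. \<exists>n. I n \<subseteq> B `` {z}}" for z
  define M where "M = {B \<in> \<B>. \<exists>n. \<exists>z\<in>X. I n \<subseteq> B `` {z}}"
  have centre: "map_centre X \<B> Y (as_multimap (restrict f Y)) = {z \<in> X. \<Inter>M = \<Inter>(N z)}"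
    unfolding map_centre_def M_def N_def I_def ..
  then have xX: "x \<in> X" and Mx: "\<Inter>M = \<Inter>(N x)"
    using x by auto
  have "N x \<subseteq> N (f x)"
  proof
    fix B assume "B \<in> N x"
    then obtain n where B: "B \<in> \<B>" and n: "I n \<subseteq> B `` {x}"
      unfolding N_def by blast
    have "I (Suc n) = f ` I n"
      unfolding I_def by (rule mimage_restrict_Suc[OF fY])
    also have "\<dots> \<subseteq> f ` (B `` {x})"
      using n by (rule image_mono)
    also have "\<dots> \<subseteq> B `` {f x}"
      by (rule nonexpansive_as_multimapD[OF nonexp xX B])
    finally show "B \<in> N (f x)"
      unfolding N_def using B by blast
  qed
  moreover have "N (f x) \<subseteq> M"
    unfolding N_def M_def using fx by blast
  ultimately have "\<Inter>M = \<Inter>(N (f x))"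
    using Mx by (metis Inter_anti_mono subset_antisym)
  then show ?thesis
    using fx centre by simp
qed

theorem theorem8:
  fixes X Y :: "'a set" and \<B> :: "'a rel set"
    and F :: "'a \<Rightarrow> 'a set" and f :: "'a \<Rightarrow> 'a" and x :: 'a
  assumes "primitive_uniform_space X \<B>"
    and "multimap_on X F"
    and "\<And>z. z \<in> X \<Longrightarrow> is_singleton (set_centre X \<B> (F z))"
    and "\<And>z. z \<in> X \<Longrightarrow> set_centre X \<B> (F z) \<subseteq> F z"
    and "\<And>z. z \<in> X \<Longrightarrow> f z \<in> set_centre X \<B> (F z)"
    and "nonexpansive X \<B> (as_multimap f)"
    and "Y \<noteq> {}" and "Y \<subseteq> X"
  shows "(mimage F Y \<subseteq> Y \<longrightarrow> f ` Y \<subseteq> Y) \<and>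
    (f ` Y \<subseteq> Y \<and> x \<in> map_centre X \<B> Y (as_multimap (restrict f Y)) \<longrightarrow>
       f x \<in> map_centre X \<B> Y (as_multimap (restrict f Y)) \<and>
       (is_singleton (map_centre X \<B> Y (as_multimap (restrict f Y))) \<longrightarrow> x \<in> F x))"
proof (intro conjI impI)
  have selection: "f z \<in> F z" if "z \<in> X" for z
    using assms(4,5) that by blast
  show "f ` Y \<subseteq> Y" if "mimage F Y \<subseteq> Y"
    using that selection \<open>Y \<subseteq> X\<close> unfolding mimage_def by blast
  let ?C = "map_centre X \<B> Y (as_multimap (restrict f Y))"
  assume "f ` Y \<subseteq> Y \<and> x \<in> ?C"
  then have fY: "f ` Y \<subseteq> Y" and x: "x \<in> ?C"
    by auto
  have xX: "x \<in> X"
    using x unfolding map_centre_def by blast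
  have "f x \<in> X"
    using assms(5)[OF xX] unfolding set_centre_def by blast
  then show fx: "f x \<in> ?C"
    by (rule map_centre_invariant[OF assms(6) fY x])
  assume "is_singleton ?C"
  then have "f x = x"
    using x fx by (metis is_singletonE singletonD)
  then show "x \<in> F x"
    using selection[OF xX] by simp
qed

end
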